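(* Let $\Lambda=\langle A,R\rangle$ be an argumentation framework, $g\in A$, $\sigma\in\{\mathtt{co},\mathtt{st},\mathtt{pr},\mathtt{sst}\}$, $\mathcal{L}\in\sigma(\Lambda)$ and $T\in\{CF,SF\}$. Then the algorithm $\textsc{Explain}(\Lambda,g,\sigma,\mathcal{L},T)$ (defined in the context) is sound and complete: the set of labellings it returns is exactly $\mathcal{CF}^{\sigma}(g,\mathcal{L})$ if $T=CF$, and exactly $\mathcal{SF}^{\sigma}(g,\mathcal{L})$ if $T=SF$.
   Context: An argumentation framework (AF) is a pair $\Lambda=\langle A,R\rangle$ with $A$ a (finite) set of arguments and $R\subseteq A\times A$ a set of attacks. For $S\subseteq A$ let $\mathit{Def}(S)=\{a\in A\mid \exists b\in S,\ (b,a)\in R\}$ and $\mathit{Acc}(S)=\{a\in A\mid \forall (b,a)\in R,\ b\in \mathit{Def}(S)\}$. $S$ is conflict-free iff $S\cap \mathit{Def}(S)=\emptyset$, and admissible iff it is conflict-free and $S\subseteq \mathit{Acc}(S)$. A set $S\subseteq A$ is an extension called: complete ($\mathtt{co}$) iff it is admissible and $S=\mathit{Acc}(S)$; preferred ($\mathtt{pr}$) iff it is a $\subseteq$-maximal complete extension; stable ($\mathtt{st}$) iff it is a preferred extension with $S\cup \mathit{Def}(S)=A$; semi-stable ($\mathtt{sst}$) iff it is a preferred extension such that $S\cup \mathit{Def}(S)$ is $\subseteq$-maximal (among preferred extensions). A labelling is a total function $\mathcal{L}:A\to\{\mathbf{in},\mathbf{out},\mathbf{und}\}$. The labelling corresponding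 to an extension $E$ assigns $\mathbf{in}$ to the elements of $E$, $\mathbf{out}$ to the elements of $\mathit{Def}(E)$, and $\mathbf{und}$ to all other arguments. A $\sigma$-labelling of $\Lambda$ is the labelling corresponding to a $\sigma$-extension of $\Lambda$; $\sigma(\Lambda)$ denotes the set of $\sigma$-labellings of $\Lambda$. The distance between labellings is $\delta(\mathcal{L},\mathcal{L}')=|\{a\in A\mid \mathcal{L}(a)\neq\mathcal{L}'(a)\}|$. Counterfactuals: $\mathcal{CF}^{\sigma}(g,\mathcal{L})$ is the set of $\mathcal{L}'\in\sigma(\Lambda)$ such that (i) $\mathcal{L}(g)\neq\mathcal{L}'(g)$, and (ii) there is no $\mathcal{L}''\in\sigma(\Lambda)$ with $\mathcal{L}(g)\neq\mathcal{L}''(g)$ and $\delta(\mathcal{L},\mathcal{L}'')<\delta(\mathcal{L},\mathcal{L}')$. Semifactuals: $\mathcal{SF}^{\sigma}(g,\mathcal{L})$ is the set of $\mathcal{L}'\in\sigma(\Lambda)$ such that (i) $\mathcal{L}(g)=\mathcal{L}'(g)$, and (ii) there is no $\mathcal{L}''\in\sigma(\Lambda)$ with $\mathcal{L}(g)=\mathcal{L}''(g)$ and $\delta(\mathcal{L},\mathcal{L}'')>\delta(\mathcal{L},\mathcal{L}')$. For a labelling $\mathcal{L}$ and $a\in A$, $\ell(\mathcal{L},a)$ is the atom $\mathbf{in}(a)$, $\mathbf{out}(a)$ or $\mathbf{und}(a)$ according to whether $\mathcal{L}(a)=\mathbf{in}$, $\mathbf{out}$ or $\mathbf{und}$. Algorithm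 $\textsc{Explain}(\Lambda,g,\sigma,\mathcal{L},T)$ builds an Answer Set Programming (ASP) program as the union of four parts. - $P_\Lambda=\{\mathbf{arg}(a)\mid a\in A\}\cup\{\mathbf{att}(a,b)\mid (a,b)\in R\}$ (facts). - $P_\sigma$: an ASP encoding of the semantics $\sigma$, i.e. a fixed program, not mentioning the predicate $\mathbf{w}$, such that the answer sets of $P_\Lambda\cup P_\sigma$ are in one-to-one correspondence with the $\sigma$-labellings of $\Lambda$, the answer set $M$ corresponding to $\mathcal{L}'$ satisfying $M\cap\{\mathbf{in}(a),\mathbf{out}(a),\mathbf{und}(a)\mid a\in A\}=\{\ell(\mathcal{L}',a)\mid a\in A\}$. For example, $P_{\mathtt{st}}$ consists of the rules: $\mathbf{in}(X)\leftarrow \mathbf{not}\ \mathbf{out}(X),\mathbf{arg}(X)$; $\mathbf{out}(X)\leftarrow \mathbf{not}\ \mathbf{in}(X),\mathbf{arg}(X)$; $\mathbf{defeated}(X)\leftarrow \mathbf{in}(Y),\mathbf{att}(Y,X)$; $\leftarrow \mathbf{in}(X),\mathbf{in}(Y),\mathbf{att}(X,Y)$; $\leftarrow \mathbf{out}(X),\mathbf{not}\ \mathbf{defeated}(X)$. - $P_S$: if $T=CF$, the single constraint $\leftarrow \ell(\mathcal{L},g)$; if $T=SF$, the single constraint $\leftarrow \mathbf{not}\ \ell(\mathcal{L},g)$. - $P_W$: if $T=CF$, the rules $\mathbf{w}(a)\leftarrow \mathbf{not}\ \ell(\mathcal{L},a)$ for all $a\in A\setminus\{g\}$; if $T=SF$,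 the rules $\mathbf{w}(a)\leftarrow \ell(\mathcal{L},a)$ for all $a\in A\setminus\{g\}$. The algorithm then invokes the solver asprin on $P=P_\Lambda\cup P_\sigma\cup P_S\cup P_W$ with the preference statement $\texttt{\#preference(p,less(cardinality))}\{\mathbf{w}(X):\mathbf{arg}(X)\}$ and the directive $\texttt{\#optimize(p)}$. That is, it computes all optimal answer sets of $P$, namely those answer sets $M$ of $P$ for which no answer set $M'$ of $P$ satisfies $|\{a\mid \mathbf{w}(a)\in M'\}|<|\{a\mid\mathbf{w}(a)\in M\}|$, and returns the set of labellings corresponding to them (each answer set being read as the labelling given by its $\mathbf{in}$, $\mathbf{out}$, $\mathbf{und}$ atoms). Answer sets are the usual stable models of a logic program; a rule with empty head is a constraint that eliminates the answer sets satisfying its body. *)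

theory Defs
  imports Main "HOL-Library.FuncSet"
begin

section \<open>Argumentation frameworks\<close>

record 'a af =
  args :: "'a set"
  attacks :: "('a \<times> 'a) set"

definition wf_af :: "'a af \<Rightarrow> bool" where
  "wf_af F \<longleftrightarrow> finite (args F) \<and> attacks F \<subseteq> args F \<times> args F"

definition Def :: "'a af \<Rightarrow> 'a set \<Rightarrow> 'a set" where
  "Def F S = {a \<in> args F. \<exists>b\<in>S. (b, a) \<in> attacks F}"

definition Acc :: "'a af \<Rightarrow> 'a set \<Rightarrow> 'a set" where
  "Acc F S = {a \<in> args F. \<forall>b. (b, a) \<in> attacks F \<longrightarrow> b \<in> Def F S}"

definition conflict_free :: "'a af \<Rightarrow> 'a set \<Rightarrow> bool" where
  "conflict_free F S \<longleftrightarrow> S \<inter> Def F S = {}"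

definition admissible :: "'a af \<Rightarrow> 'a set \<Rightarrow> bool" where
  "admissible F S \<longleftrightarrow> conflict_free F S \<and> S \<subseteq> Acc F S"

definition complete_ext :: "'a af \<Rightarrow> 'a set \<Rightarrow> bool" where
  "complete_ext F S \<longleftrightarrow> S \<subseteq> args F \<and> admissible F S \<and> S = Acc F S"

definition preferred_ext :: "'a af \<Rightarrow> 'a set \<Rightarrow> bool" where
  "preferred_ext F S \<longleftrightarrow> complete_ext F S \<and> \<not> (\<exists>S'. complete_ext F S' \<and> S \<subset> S')"

definition stable_ext :: "'a af \<Rightarrow> 'a set \<Rightarrow> bool" where
  "stable_ext F S \<longleftrightarrow> preferred_ext F S \<and> S \<union> Def F S = args F"

definition semistable_ext :: "'a af \<Rightarrow> 'a set \<Rightarrow> bool" where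
  "semistable_ext F S \<longleftrightarrow> preferred_ext F S \<and>
     \<not> (\<exists>S'. preferred_ext F S' \<and> S \<union> Def F S \<subset> S' \<union> Def F S')"

datatype semantics = CO | ST | PR | SST

fun extension :: "semantics \<Rightarrow> 'a af \<Rightarrow> 'a set \<Rightarrow> bool" where
  "extension CO = complete_ext"
| "extension ST = stable_ext"
| "extension PR = preferred_ext"
| "extension SST = semistable_ext"


section \<open>Labellings, counterfactuals and semifactuals\<close>

datatype label = In | Out | Und

text \<open>A labelling of \<open>F\<close> is an element of \<open>args F \<rightarrow>\<^sub>E UNIV\<close>: it is \<open>undefined\<close> outside \<open>args F\<close>,
  so that equality of labellings is equality on the arguments.\<close>

definition ext_labelling :: "'a af \<Rightarrow> 'a set \<Rightarrow> 'a \<Rightarrow> label" where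
  "ext_labelling F E =
     (\<lambda>a\<in>args F. if a \<in> E then In else if a \<in> Def F E then Out else Und)"

definition labellings :: "semantics \<Rightarrow> 'a af \<Rightarrow> ('a \<Rightarrow> label) set" where
  "labellings \<sigma> F = {ext_labelling F E | E. extension \<sigma> F E}"

definition label_dist :: "'a af \<Rightarrow> ('a \<Rightarrow> label) \<Rightarrow> ('a \<Rightarrow> label) \<Rightarrow> nat" where
  "label_dist F L L' = card {a \<in> args F. L a \<noteq> L' a}"

definition counterfactuals ::
  "semantics \<Rightarrow> 'a af \<Rightarrow> 'a \<Rightarrow> ('a \<Rightarrow> label) \<Rightarrow> ('a \<Rightarrow> label) set" where
  "counterfactuals \<sigma> F g L = {L' \<in> labellings \<sigma> F. L g \<noteq> L' g \<and>
     \<not> (\<exists>L''\<in>labellings \<sigma> F. L g \<noteq> L'' g \<and> label_dist F L L'' < label_dist F L L')}"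

definition semifactuals ::
  "semantics \<Rightarrow> 'a af \<Rightarrow> 'a \<Rightarrow> ('a \<Rightarrow> label) \<Rightarrow> ('a \<Rightarrow> label) set" where
  "semifactuals \<sigma> F g L = {L' \<in> labellings \<sigma> F. L g = L' g \<and>
     \<not> (\<exists>L''\<in>labellings \<sigma> F. L g = L'' g \<and> label_dist F L L'' > label_dist F L L')}"


section \<open>Answer set programs\<close>

text \<open>Programs are (possibly disjunctive, function-free) logic programs with default negation.
  The type parameter of atoms and rules is the type of the terms: \<open>'a trm\<close> for programs with
  variables, and the constants \<open>'a\<close> themselves for ground programs. A rule with an empty head
  is a constraint.\<close>

datatype 'a trm = Var string | Const 'a

datatype pred = P_arg | P_att | P_in | P_out | P_und | P_w | P_aux string

datatype 't atm = Atm (pred_of: pred) (terms_of: "'t list")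

datatype 't rule = Rule (head: "'t atm list") (pos: "'t atm list") (neg: "'t atm list")

type_synonym 'a program = "'a trm rule set"
type_synonym 'a ground_program = "'a rule set"

definition rule_atoms :: "'t rule \<Rightarrow> 't atm set" where
  "rule_atoms r = set (head r) \<union> set (pos r) \<union> set (neg r)"

definition mentions :: "'t rule set \<Rightarrow> pred \<Rightarrow> bool" where
  "mentions P p \<longleftrightarrow> (\<exists>r\<in>P. \<exists>a\<in>rule_atoms r. pred_of a = p)"

definition herbrand_universe :: "'a program \<Rightarrow> 'a set" where
  "herbrand_universe P = {c. \<exists>r\<in>P. Const c \<in> set_rule r}"

fun subst :: "(string \<Rightarrow> 'a) \<Rightarrow> 'a trm \<Rightarrow> 'a" where
  "subst \<theta> (Var x) = \<theta> x"
| "subst \<theta> (Const c) = c"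

definition ground :: "'a program \<Rightarrow> 'a ground_program" where
  "ground P = {map_rule (subst \<theta>) r | \<theta> r.
     r \<in> P \<and> (\<forall>x. Var x \<in> set_rule r \<longrightarrow> \<theta> x \<in> herbrand_universe P)}"

definition reduct :: "'a ground_program \<Rightarrow> 'a atm set \<Rightarrow> 'a ground_program" where
  "reduct G M = {Rule (head r) (pos r) [] | r. r \<in> G \<and> set (neg r) \<inter> M = {}}"

text \<open>Only used for programs without default negation.\<close>

definition is_model :: "'a ground_program \<Rightarrow> 'a atm set \<Rightarrow> bool" where
  "is_model G M \<longleftrightarrow> (\<forall>r\<in>G. set (pos r) \<subseteq> M \<longrightarrow> set (head r) \<inter> M \<noteq> {})"

definition stable_model :: "'a ground_program \<Rightarrow> 'a atm set \<Rightarrow> bool" where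
  "stable_model G M \<longleftrightarrow>
     is_model (reduct G M) M \<and> \<not> (\<exists>N. N \<subset> M \<and> is_model (reduct G M) N)"

definition answer_sets :: "'a program \<Rightarrow> 'a atm set set" where
  "answer_sets P = {M. stable_model (ground P) M}"


section \<open>The algorithm\<close>

fun label_pred :: "label \<Rightarrow> pred" where
  "label_pred In = P_in"
| "label_pred Out = P_out"
| "label_pred Und = P_und"

definition label_atom :: "('a \<Rightarrow> label) \<Rightarrow> 'a \<Rightarrow> 'a atm" where
  "label_atom L a = Atm (label_pred (L a)) [a]"

definition label_atoms :: "'a af \<Rightarrow> 'a atm set" where
  "label_atoms F = {Atm p [a] | p a. p \<in> {P_in, P_out, P_und} \<and> a \<in> args F}"

text \<open>The labelling given by the in/out/und atoms of a set of ground atoms.\<close>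

definition represents :: "'a af \<Rightarrow> 'a atm set \<Rightarrow> ('a \<Rightarrow> label) \<Rightarrow> bool" where
  "represents F M L \<longleftrightarrow> L \<in> args F \<rightarrow>\<^sub>E UNIV \<and> M \<inter> label_atoms F = label_atom L ` args F"

definition prog_af :: "'a af \<Rightarrow> 'a program" where
  "prog_af F = {Rule [Atm P_arg [Const a]] [] [] | a. a \<in> args F}
     \<union> {Rule [Atm P_att [Const a, Const b]] [] [] | a b. (a, b) \<in> attacks F}"

definition asp_encoding :: "'a af \<Rightarrow> semantics \<Rightarrow> 'a program \<Rightarrow> bool" where
  "asp_encoding F \<sigma> P \<longleftrightarrow> \<not> mentions P P_w \<and>
     (\<exists>f. bij_betw f (labellings \<sigma> F) (answer_sets (prog_af F \<union> P)) \<and>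
          (\<forall>L\<in>labellings \<sigma> F. represents F (f L) L))"

datatype explanation_type = CF | SF

abbreviation label_lit :: "('a \<Rightarrow> label) \<Rightarrow> 'a \<Rightarrow> 'a trm atm" where
  "label_lit L a \<equiv> map_atm Const (label_atom L a)"

fun prog_S :: "'a \<Rightarrow> ('a \<Rightarrow> label) \<Rightarrow> explanation_type \<Rightarrow> 'a program" where
  "prog_S g L CF = {Rule [] [label_lit L g] []}"
| "prog_S g L SF = {Rule [] [] [label_lit L g]}"

fun prog_W :: "'a af \<Rightarrow> 'a \<Rightarrow> ('a \<Rightarrow> label) \<Rightarrow> explanation_type \<Rightarrow> 'a program" where
  "prog_W F g L CF = {Rule [Atm P_w [Const a]] [] [label_lit L a] | a. a \<in> args F - {g}}"
| "prog_W F g L SF = {Rule [Atm P_w [Const a]] [label_lit L a] [] | a. a \<in> args F - {g}}"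

definition w_cost :: "'a atm set \<Rightarrow> nat" where
  "w_cost M = card {a. Atm P_w [a] \<in> M}"

definition optimal_answer_sets :: "'a program \<Rightarrow> 'a atm set set" where
  "optimal_answer_sets P =
     {M \<in> answer_sets P. \<not> (\<exists>M'\<in>answer_sets P. w_cost M' < w_cost M)}"

text \<open>The first argument supplies the encoding of each semantics.\<close>

definition explain ::
  "(semantics \<Rightarrow> 'a program) \<Rightarrow> 'a af \<Rightarrow> 'a \<Rightarrow> semantics \<Rightarrow> ('a \<Rightarrow> label) \<Rightarrow> explanation_type
     \<Rightarrow> ('a \<Rightarrow> label) set" where
  "explain enc F g \<sigma> L T =
     {L'. \<exists>M \<in> optimal_answer_sets (prog_af F \<union> enc \<sigma> \<union> prog_S g L T \<union> prog_W F g L T).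
            represents F M L'}"

end

theory Submission imports Defs begin

text \<open>
  The predicate \<open>w\<close> occurs in \<open>P\<^sub>W\<close> only, where it is explicitly defined in terms of the other
  atoms, and \<open>P\<^sub>S\<close> is a constraint. Hence removing the \<open>w\<close>-atoms is a bijection from the answer
  sets of the whole program onto the answer sets of the encoding that satisfy the constraint,
  i.e. onto the \<open>\<sigma>\<close>-labellings \<open>L'\<close> for which \<open>L g \<noteq> L' g\<close> (for \<open>CF\<close>) or \<open>L g = L' g\<close> (for
  \<open>SF\<close>). For these, the number of \<open>w\<close>-atoms is the distance to \<open>L\<close> minus one (for \<open>CF\<close>) or
  \<open>|A| - 1\<close> minus the distance to \<open>L\<close> (for \<open>SF\<close>), so that minimising it means minimising or
  maximising the distance, respectively.
\<close>

section \<open>Adding explicit definitions and constraints\<close>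

definition fires :: "'t atm set \<Rightarrow> 't rule \<Rightarrow> bool" where
  "fires M r \<longleftrightarrow> set (pos r) \<subseteq> M \<and> set (neg r) \<inter> M = {}"

lemma is_model_reduct:
  "is_model (reduct G M) N \<longleftrightarrow>
    (\<forall>r\<in>G. set (neg r) \<inter> M = {} \<longrightarrow> set (pos r) \<subseteq> N \<longrightarrow> set (head r) \<inter> N \<noteq> {})"
  unfolding is_model_def reduct_def by fastforce

text \<open>Atoms of \<open>U\<close> occur in no rule of \<open>G\<close>, so they influence
  neither which rules survive in the reduct nor which of these are satisfied. This permits passing
  freely between \<open>M\<close> and \<open>M - U\<close>.\<close>

lemma is_model_reduct_cong:
  assumes "\<And>r. r \<in> G \<Longrightarrow> rule_atoms r \<inter> U = {}" and "M - U = M' - U" and "N - U = N' - U"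
  shows "is_model (reduct G M) N \<longleftrightarrow> is_model (reduct G M') N'"
proof -
  have "(set (neg r) \<inter> M = {} \<longleftrightarrow> set (neg r) \<inter> M' = {}) \<and>
      (set (pos r) \<subseteq> N \<longleftrightarrow> set (pos r) \<subseteq> N') \<and>
      (set (head r) \<inter> N = {} \<longleftrightarrow> set (head r) \<inter> N' = {})" if "r \<in> G" for r
    using assms(1)[OF that] assms(2,3) unfolding rule_atoms_def by blast
  then show ?thesis
    unfolding is_model_reduct by (intro ball_cong refl) simp
qed

lemma is_model_reduct_Un:
  "is_model (reduct (G \<union> H) M) N \<longleftrightarrow> is_model (reduct G M) N \<and> is_model (reduct H M) N"
  unfolding is_model_reduct by blast

text \<open>A special case of the splitting set theorem. The bodies of \<open>H\<close> avoid
  \<open>U\<close>, so the definitions in \<open>H\<close> are not recursive and are evaluated in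
  one pass once \<open>M - U\<close> is known. Heads with at most one atom leave no choice; an empty
  head is a constraint.\<close>

lemma stable_model_definitional_extension:
  assumes G: "\<And>r. r \<in> G \<Longrightarrow> rule_atoms r \<inter> U = {}"
    and hd: "\<And>r. r \<in> H \<Longrightarrow> set (head r) \<subseteq> U"
    and single: "\<And>r. r \<in> H \<Longrightarrow> length (head r) \<le> 1"
    and body: "\<And>r. r \<in> H \<Longrightarrow> (set (pos r) \<union> set (neg r)) \<inter> U = {}"
  shows "stable_model (G \<union> H) M \<longleftrightarrow>
    stable_model G (M - U) \<and> (\<forall>r\<in>H. fires (M - U) r \<longrightarrow> head r \<noteq> []) \<and>
    M \<inter> U = \<Union> {set (head r) | r. r \<in> H \<and> fires (M - U) r}"
    (is "?lhs \<longleftrightarrow> ?st \<and> ?con \<and> M \<inter> U = ?D")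
proof
  assume lhs: ?lhs
  then have mG: "is_model (reduct G M) M" and mH: "is_model (reduct H M) M"
    and min: "\<And>N. N \<subset> M \<Longrightarrow> is_model (reduct G M) N \<Longrightarrow> is_model (reduct H M) N \<Longrightarrow> False"
    unfolding stable_model_def is_model_reduct_Un by blast+
  have fires: "fires (M - U) r \<longleftrightarrow> set (pos r) \<subseteq> M \<and> set (neg r) \<inter> M = {}" if "r \<in> H" for r
    using body[OF that] unfolding fires_def by blast
  \<comment> \<open>\<open>M\<close> meets the head of every firing rule; as the head has at most
    one atom, it is a singleton inside \<open>M\<close>.\<close>
  have head_M: "set (head r) \<subseteq> M" "head r \<noteq> []" if "r \<in> H" "fires (M - U) r" for r
  proof -
    have ne: "set (head r) \<inter> M \<noteq> {}"
      using mH that fires unfolding is_model_reduct by blast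
    then show "head r \<noteq> []" by auto
    then obtain x where "head r = [x]"
      using single[OF \<open>r \<in> H\<close>] by (cases "head r") auto
    then show "set (head r) \<subseteq> M" using ne by simp
  qed
  have ?st
    unfolding stable_model_def
  proof (intro conjI notI)
    show "is_model (reduct G (M - U)) (M - U)"
      using mG is_model_reduct_cong
          [OF G, where M = M and M' = "M - U" and N = M and N' = "M - U"]
      by simp
    assume "\<exists>N\<subset>M - U. is_model (reduct G (M - U)) N"
    then obtain N where N: "N \<subset> M - U" "is_model (reduct G (M - U)) N" by blast
    \<comment> \<open>A smaller model for \<open>G\<close> alone is completed by all
      \<open>U\<close>-atoms of \<open>M\<close>. These satisfy every firing rule of
      \<open>H\<close>, so the result contradicts the minimality of \<open>M\<close>.\<close>
    let ?N = "N \<union> (M \<inter> U)"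
    have eq: "?N - U = N - U" by blast
    have "is_model (reduct G M) ?N"
      using N(2) is_model_reduct_cong
          [OF G, where M = M and M' = "M - U" and N = ?N and N' = N] eq
      by simp
    moreover have "is_model (reduct H M) ?N"
      unfolding is_model_reduct
    proof (intro ballI impI)
      fix r assume r: "r \<in> H" "set (neg r) \<inter> M = {}" "set (pos r) \<subseteq> ?N"
      then have "fires (M - U) r" using fires N(1) by blast
      then show "set (head r) \<inter> ?N \<noteq> {}"
        using head_M[of r] hd[of r] r(1) by (cases "head r") auto
    qed
    moreover have "?N \<subset> M" using N(1) by blast
    ultimately show False using min by blast
  qed
  moreover have "M \<inter> U = ?D"
  proof
    show "?D \<subseteq> M \<inter> U" using head_M hd by blast
    show "M \<inter> U \<subseteq> ?D"
    proof (rule ccontr)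
      assume "\<not> M \<inter> U \<subseteq> ?D"
      \<comment> \<open>No firing rule derives \<open>x\<close> and no rule of \<open>G\<close>
        contains it, so deleting \<open>x\<close> alone yields a smaller model of the
        reduct.\<close>
      then obtain x where x: "x \<in> M" "x \<in> U" "x \<notin> ?D" by blast
      have eq: "M - {x} - U = M - U" using x by blast
      have "is_model (reduct G M) (M - {x})"
        using mG is_model_reduct_cong
          [OF G, where M = M and M' = M and N = "M - {x}" and N' = M] eq
      by simp
      moreover have "is_model (reduct H M) (M - {x})"
        unfolding is_model_reduct
      proof (intro ballI impI)
        fix r assume r: "r \<in> H" "set (neg r) \<inter> M = {}" "set (pos r) \<subseteq> M - {x}"
        then have f: "fires (M - U) r" using fires by blast
        then have "set (head r) \<subseteq> ?D" using r(1) by blast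
        then show "set (head r) \<inter> (M - {x}) \<noteq> {}"
          using head_M[OF r(1) f] x(3) by (cases "head r") auto
      qed
      ultimately show False using min[of "M - {x}"] x(1) by blast
    qed
  qed
  ultimately show "?st \<and> ?con \<and> M \<inter> U = ?D" using head_M by blast
next
  assume "?st \<and> ?con \<and> M \<inter> U = ?D"
  then have st: ?st and con: ?con and D: "M \<inter> U = ?D" by blast+
  show ?lhs
    unfolding stable_model_def is_model_reduct_Un
  proof (intro conjI notI)
    show "is_model (reduct G M) M"
      using st is_model_reduct_cong[OF G, where M = M and M' = "M - U" and N = M and N' = "M - U"]
      unfolding stable_model_def by simp
    show "is_model (reduct H M) M"
      unfolding is_model_reduct
    proof (intro ballI impI)
      fix r assume r: "r \<in> H" "set (neg r) \<inter> M = {}" "set (pos r) \<subseteq> M"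
      then have f: "fires (M - U) r" using body[of r] unfolding fires_def by blast
      then have "set (head r) \<subseteq> M" using D r(1) by blast
      then show "set (head r) \<inter> M \<noteq> {}" using con r(1) f by (cases "head r") auto
    qed
    assume "\<exists>N\<subset>M. is_model (reduct G M) N \<and> is_model (reduct H M) N"
    then obtain N where N: "N \<subset> M" "is_model (reduct G M) N" "is_model (reduct H M) N" by blast
    \<comment> \<open>Minimality of \<open>M - U\<close> for \<open>G\<close> forces
      \<open>N\<close> to agree with \<open>M\<close> outside \<open>U\<close>. The same rules of
      \<open>H\<close> then fire and put all \<open>U\<close>-atoms of \<open>M\<close> into
      \<open>N\<close>, so \<open>N\<close> is not smaller.\<close>
    have "is_model (reduct G (M - U)) (N - U)"
      using N(2) is_model_reduct_cong
          [OF G, where M = M and M' = "M - U" and N = N and N' = "N - U"]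
      by simp
    moreover have "\<forall>K. K \<subset> M - U \<longrightarrow> \<not> is_model (reduct G (M - U)) K"
      using st unfolding stable_model_def by simp
    ultimately have "\<not> N - U \<subset> M - U" by meson
    then have eq: "N - U = M - U" using N(1) by blast
    have "M \<inter> U \<subseteq> N"
    proof
      fix x assume "x \<in> M \<inter> U"
      then have "x \<in> ?D" using D by simp
      then obtain r where r: "r \<in> H" "fires (M - U) r" "x \<in> set (head r)" by blast
      have "set (neg r) \<inter> M = {}" "set (pos r) \<subseteq> N"
        using r(2) body[OF r(1)] eq unfolding fires_def by blast+
      then have "set (head r) \<inter> N \<noteq> {}"
        using N(3) r(1) unfolding is_model_reduct by blast
      then show "x \<in> N"
        using single[OF r(1)] r(3) by (cases "head r") auto
    qed
    then show False using eq N(1) by blast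
  qed
qed

text \<open>The case of no definitions at all: the set of derived \<open>U\<close>-atoms is then
  empty.\<close>

lemma stable_model_disjoint:
  assumes "stable_model G M" and G: "\<And>r. r \<in> G \<Longrightarrow> rule_atoms r \<inter> U = {}"
  shows "M \<inter> U = {}"
  using stable_model_definitional_extension[OF G, where H = "{}" and M = M] assms(1) by simp

section \<open>Grounding\<close>

lemma subst_comp_Const: "subst \<theta> \<circ> Const = id"
  by auto

text \<open>The constants of \<open>H\<close> are already in the Herbrand universe, so the rules of
  \<open>P\<close> gain no new instances, and a rule without variables has only itself as
  instance.\<close>

lemma ground_Un_variable_free:
  assumes "\<Union> (set_rule ` H) \<subseteq> herbrand_universe P"
  shows "ground (P \<union> map_rule Const ` H) = ground P \<union> H"
proof -
  have eq: "herbrand_universe (P \<union> map_rule Const ` H) = herbrand_universe P"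
    using assms unfolding herbrand_universe_def by (fastforce simp: rule.set_map)
  have "ground (P \<union> map_rule Const ` H) = ground P \<union>
      {map_rule (subst \<theta>) r | \<theta> r. r \<in> map_rule Const ` H \<and>
        (\<forall>x. Var x \<in> set_rule r \<longrightarrow> \<theta> x \<in> herbrand_universe P)}"
    unfolding ground_def eq by blast
  moreover have "{map_rule (subst \<theta>) r | \<theta> r. r \<in> map_rule Const ` H \<and>
      (\<forall>x. Var x \<in> set_rule r \<longrightarrow> \<theta> x \<in> herbrand_universe P)} = H" (is "?I = H")
  proof
    have inst: "map_rule (subst \<theta>) (map_rule Const r) = r" for \<theta> and r :: "'a rule"
      by (simp add: rule.map_comp subst_comp_Const rule.map_id)
    show "?I \<subseteq> H" by (auto simp: inst)
    show "H \<subseteq> ?I"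
    proof
      fix r assume "r \<in> H"
      moreover have "Var x \<notin> set_rule (map_rule Const r)" for x
        by (auto simp: rule.set_map)
      \<comment> \<open>Any substitution serves as witness, since there is no variable whose value
        would have to lie in the Herbrand universe.\<close>
      ultimately show "r \<in> ?I" using inst[of undefined r, symmetric] by blast
    qed
  qed
  ultimately show ?thesis by simp
qed

lemma rule_atoms_map_rule: "rule_atoms (map_rule h r) = map_atm h ` rule_atoms r"
  unfolding rule_atoms_def by (cases r) auto

lemma ground_not_mentions:
  assumes "\<not> mentions P p" and "r \<in> ground P"
  shows "rule_atoms r \<inter> {x. pred_of x = p} = {}"
  using assms unfolding ground_def mentions_def
  by (fastforce simp: rule_atoms_map_rule atm.map_sel)

lemma answer_set_not_mentions:
  assumes "\<not> mentions P p" and "M \<in> answer_sets P"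
  shows "M \<inter> {x. pred_of x = p} = {}"
  using stable_model_disjoint ground_not_mentions[OF assms(1)] assms(2)
  unfolding answer_sets_def by blast

section \<open>The program of the algorithm\<close>

text \<open>The same relation is the requirement imposed on \<open>g\<close> and the condition for
  deriving \<open>w\<close> at the other arguments. This lets both explanation types be treated
  together.\<close>

fun compares :: "explanation_type \<Rightarrow> label \<Rightarrow> label \<Rightarrow> bool" where
  "compares CF l l' \<longleftrightarrow> l \<noteq> l'"
| "compares SF l l' \<longleftrightarrow> l = l'"

fun query_rule :: "'a \<Rightarrow> ('a \<Rightarrow> label) \<Rightarrow> explanation_type \<Rightarrow> 'a rule" where
  "query_rule g L CF = Rule [] [label_atom L g] []"
| "query_rule g L SF = Rule [] [] [label_atom L g]"

fun weight_rule :: "('a \<Rightarrow> label) \<Rightarrow> explanation_type \<Rightarrow> 'a \<Rightarrow> 'a rule" where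
  "weight_rule L CF a = Rule [Atm P_w [a]] [] [label_atom L a]"
| "weight_rule L SF a = Rule [Atm P_w [a]] [label_atom L a] []"

text \<open>Stated with ground rules, so that \<open>ground_Un_variable_free\<close> can add it
  after grounding the rest of the program.\<close>

definition query_program ::
  "'a af \<Rightarrow> 'a \<Rightarrow> ('a \<Rightarrow> label) \<Rightarrow> explanation_type \<Rightarrow> 'a ground_program" where
  "query_program F g L T = insert (query_rule g L T) (weight_rule L T ` (args F - {g}))"

definition weight_atoms ::
  "'a af \<Rightarrow> 'a \<Rightarrow> ('a \<Rightarrow> label) \<Rightarrow> explanation_type \<Rightarrow> ('a \<Rightarrow> label) \<Rightarrow> 'a atm set" where
  "weight_atoms F g L T L' = {Atm P_w [a] | a. a \<in> args F - {g} \<and> compares T (L a) (L' a)}"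

lemma prog_S_prog_W:
  "prog_S g L T \<union> prog_W F g L T = map_rule Const ` query_program F g L T"
  by (cases T) (auto simp: query_program_def image_image)

lemma pred_of_label_atom: "pred_of (label_atom L a) \<noteq> P_w"
  by (cases "L a") (simp_all add: label_atom_def)

lemma query_program_rules:
  assumes "r \<in> query_program F g L T"
  shows "set (head r) \<subseteq> {x. pred_of x = P_w}" and "length (head r) \<le> 1"
    and "(set (pos r) \<union> set (neg r)) \<inter> {x. pred_of x = P_w} = {}"
  using assms by (cases T; auto simp: query_program_def pred_of_label_atom)+

lemma stable_model_Un_query_program:
  assumes "\<And>r. r \<in> G \<Longrightarrow> rule_atoms r \<inter> {x. pred_of x = P_w} = {}"
  shows "stable_model (G \<union> query_program F g L T) M \<longleftrightarrow>
    stable_model G (M - {x. pred_of x = P_w}) \<and>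
    (\<forall>r\<in>query_program F g L T. fires (M - {x. pred_of x = P_w}) r \<longrightarrow> head r \<noteq> []) \<and>
    M \<inter> {x. pred_of x = P_w} = \<Union> {set (head r) | r.
      r \<in> query_program F g L T \<and> fires (M - {x. pred_of x = P_w}) r}"
  using assms query_program_rules
  by (rule stable_model_definitional_extension)

lemma set_atm_label_atom: "set_atm (label_atom L a) = {a}"
  by (simp add: label_atom_def)

lemma query_program_constants:
  assumes "g \<in> args F"
  shows "\<Union> (set_rule ` query_program F g L T) \<subseteq> args F"
  using assms by (cases T) (auto simp: query_program_def set_atm_label_atom)

lemma args_subset_herbrand_universe: "args F \<subseteq> herbrand_universe (prog_af F \<union> P)"
proof
  fix a assume "a \<in> args F"
  then have "Rule [Atm P_arg [Const a]] [] [] \<in> prog_af F \<union> P"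
    unfolding prog_af_def by blast
  then show "a \<in> herbrand_universe (prog_af F \<union> P)"
    unfolding herbrand_universe_def by force
qed

lemma not_mentions_prog_af_Un:
  "\<not> mentions P P_w \<Longrightarrow> \<not> mentions (prog_af F \<union> P) P_w"
  unfolding mentions_def by (auto simp: prog_af_def rule_atoms_def)

section \<open>Reading labellings off sets of atoms\<close>

lemma label_atom_eq_iff: "label_atom L a = label_atom L' b \<longleftrightarrow> a = b \<and> L a = L' b"
  by (cases "L a"; cases "L' b") (auto simp: label_atom_def)

lemma label_atom_in_label_atoms: "a \<in> args F \<Longrightarrow> label_atom L a \<in> label_atoms F"
  by (cases "L a") (auto simp: label_atom_def label_atoms_def)

lemma represents_iff:
  assumes "represents F M L'" and "a \<in> args F"
  shows "label_atom L a \<in> M \<longleftrightarrow> L a = L' a"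
proof -
  have "label_atom L a \<in> M \<longleftrightarrow> label_atom L a \<in> label_atom L' ` args F"
    using assms label_atom_in_label_atoms[OF assms(2), of L] unfolding represents_def by blast
  then show ?thesis using assms(2) by (auto simp: label_atom_eq_iff)
qed

lemma represents_unique:
  assumes "represents F M L" and "represents F M L'"
  shows "L = L'"
proof
  fix a show "L a = L' a"
  proof (cases "a \<in> args F")
    case True
    then show ?thesis
      using represents_iff[OF assms(1), of a L] represents_iff[OF assms(2), of a L] by simp
  next
    case False
    \<comment> \<open>Outside the arguments both labellings take the default value
      \<open>undefined\<close>.\<close>
    then show ?thesis using assms unfolding represents_def by (metis PiE_arb)
  qed
qed

lemma represents_cong:
  "M \<inter> label_atoms F = M' \<inter> label_atoms F \<Longrightarrow> represents F M L \<longleftrightarrow> represents F M' L"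
  unfolding represents_def by simp

lemma fires_query_rule:
  assumes "represents F M L'" and "g \<in> args F"
  shows "fires M (query_rule g L T) \<longleftrightarrow> \<not> compares T (L g) (L' g)"
  using represents_iff[OF assms, of L] by (cases T) (auto simp: fires_def)

lemma fires_weight_rule:
  assumes "represents F M L'" and "a \<in> args F"
  shows "fires M (weight_rule L T a) \<longleftrightarrow> compares T (L a) (L' a)"
  using represents_iff[OF assms, of L] by (cases T) (auto simp: fires_def)

lemma head_query_rule: "head (query_rule g L T) = []"
  by (cases T) auto

lemma head_weight_rule: "head (weight_rule L T a) = [Atm P_w [a]]"
  by (cases T) auto

text \<open>Rule bodies in the query program are label atoms, so the represented labelling
  \<open>L'\<close> decides which of them fire: the constraint exactly when \<open>L'\<close>
  violates the requirement on \<open>g\<close>, a weight rule exactly when \<open>compares\<close>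
  holds at its argument.\<close>

lemma stable_model_query_program:
  assumes G: "\<And>r. r \<in> G \<Longrightarrow> rule_atoms r \<inter> {x. pred_of x = P_w} = {}"
    and g: "g \<in> args F"
    and rep: "represents F (M - {x. pred_of x = P_w}) L'"
  shows "stable_model (G \<union> query_program F g L T) M \<longleftrightarrow>
    stable_model G (M - {x. pred_of x = P_w}) \<and> compares T (L g) (L' g) \<and>
    M \<inter> {x. pred_of x = P_w} = weight_atoms F g L T L'"
proof -
  let ?U = "{x. pred_of x = P_w}" and ?H = "query_program F g L T"
  have con: "(\<forall>r\<in>?H. fires (M - ?U) r \<longrightarrow> head r \<noteq> []) \<longleftrightarrow> compares T (L g) (L' g)"
    by (auto simp: query_program_def head_query_rule head_weight_rule fires_query_rule[OF rep g])
  have "x \<in> \<Union> {set (head r) | r. r \<in> ?H \<and> fires (M - ?U) r} \<longleftrightarrow>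
      x \<in> weight_atoms F g L T L'" for x
  proof -
    have "x \<in> \<Union> {set (head r) | r. r \<in> ?H \<and> fires (M - ?U) r} \<longleftrightarrow>
        (\<exists>r\<in>?H. fires (M - ?U) r \<and> x \<in> set (head r))"
      by blast
    also have "\<dots> \<longleftrightarrow>
        (\<exists>a\<in>args F - {g}. fires (M - ?U) (weight_rule L T a) \<and> x = Atm P_w [a])"
      by (simp add: query_program_def head_query_rule head_weight_rule)
    also have "\<dots> \<longleftrightarrow> x \<in> weight_atoms F g L T L'"
      using fires_weight_rule[OF rep] by (auto simp: weight_atoms_def)
    finally show ?thesis .
  qed
  then have "\<Union> {set (head r) | r. r \<in> ?H \<and> fires (M - ?U) r} = weight_atoms F g L T L'"
    by (rule set_eqI)
  then show ?thesis
    using stable_model_Un_query_program[OF G] con by simp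
qed

lemma answer_sets_query:
  assumes g: "g \<in> args F"
    and P: "\<not> mentions P P_w"
    and f: "f ` labellings \<sigma> F = answer_sets (prog_af F \<union> P)"
    and rep: "\<And>L'. L' \<in> labellings \<sigma> F \<Longrightarrow> represents F (f L') L'"
  shows "answer_sets (prog_af F \<union> P \<union> prog_S g L T \<union> prog_W F g L T) =
    (\<lambda>L'. f L' \<union> weight_atoms F g L T L') ` {L' \<in> labellings \<sigma> F. compares T (L g) (L' g)}"
proof -
  let ?U = "{x. pred_of x = P_w} :: 'a atm set"
  let ?G = "ground (prog_af F \<union> P)" and ?W = "weight_atoms F g L T"
  note P' = not_mentions_prog_af_Un[OF P]
  have G: "\<And>r. r \<in> ?G \<Longrightarrow> rule_atoms r \<inter> ?U = {}"
    using ground_not_mentions[OF P'] .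
  have stable_f: "stable_model ?G (f L')" if "L' \<in> labellings \<sigma> F" for L'
    using f that unfolding answer_sets_def by blast
  have disj: "f L' \<inter> ?U = {}" if "L' \<in> labellings \<sigma> F" for L'
    using answer_set_not_mentions[OF P'] f that by blast
  have W: "?W L' \<subseteq> ?U" for L'
    unfolding weight_atoms_def by auto
  have "ground (prog_af F \<union> P \<union> map_rule Const ` query_program F g L T) =
      ?G \<union> query_program F g L T"
    using query_program_constants[OF g] args_subset_herbrand_universe
    by (intro ground_Un_variable_free) (rule order_trans)
  then have ground: "ground (prog_af F \<union> P \<union> prog_S g L T \<union> prog_W F g L T) =
      ?G \<union> query_program F g L T"
    by (simp add: Un_assoc prog_S_prog_W)
  show "answer_sets (prog_af F \<union> P \<union> prog_S g L T \<union> prog_W F g L T) =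
    (\<lambda>L'. f L' \<union> ?W L') ` {L' \<in> labellings \<sigma> F. compares T (L g) (L' g)}"
    (is "?A = ?B")
  proof
    show "?B \<subseteq> ?A"
    proof
      fix M assume "M \<in> ?B"
      then obtain L' where L': "L' \<in> labellings \<sigma> F" "compares T (L g) (L' g)"
        and M: "M = f L' \<union> ?W L'" by blast
      have M': "M - ?U = f L'" "M \<inter> ?U = ?W L'"
        using M disj[OF L'(1)] W[of L'] by blast+
      show "M \<in> ?A"
        using stable_model_query_program[OF G g, where M = M and L' = L' and L = L and T = T]
          M' L' rep[OF L'(1)] stable_f[OF L'(1)]
        by (simp add: answer_sets_def ground)
    qed
    show "?A \<subseteq> ?B"
    proof
      fix M assume "M \<in> ?A"
      then have st: "stable_model (?G \<union> query_program F g L T) M"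
        by (simp add: answer_sets_def ground)
      have "stable_model ?G (M - ?U)"
        using stable_model_Un_query_program[OF G] st by simp
      \<comment> \<open>Surjectivity of \<open>f\<close> supplies the labelling behind the
        \<open>w\<close>-free part of \<open>M\<close>.\<close>
      then have "M - ?U \<in> f ` labellings \<sigma> F"
        using f by (simp add: answer_sets_def)
      then obtain L' where L': "L' \<in> labellings \<sigma> F" "M - ?U = f L'" by blast
      have "compares T (L g) (L' g) \<and> M \<inter> ?U = ?W L'"
        using stable_model_query_program[OF G g, where M = M and L' = L' and L = L and T = T]
          st L' rep[OF L'(1)] by simp
      moreover have "M = (M - ?U) \<union> (M \<inter> ?U)" by blast
      ultimately show "M \<in> ?B" using L' by auto
    qed
  qed
qed

section \<open>Cost versus distance\<close>

lemma compares_card_CF: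
  assumes "wf_af F" and "g \<in> args F" and "L g \<noteq> L' g"
  shows "label_dist F L L' = Suc (card {a \<in> args F - {g}. compares CF (L a) (L' a)})"
proof -
  \<comment> \<open>The argument \<open>g\<close> counts in the distance but has no weight rule,
    whence the successor.\<close>
  have "{a \<in> args F. L a \<noteq> L' a} = insert g {a \<in> args F - {g}. compares CF (L a) (L' a)}"
    using assms by auto
  then show ?thesis
    using assms(1) unfolding label_dist_def wf_af_def by simp
qed

text \<open>The arguments split into those where the labellings differ, those other than
  \<open>g\<close> where they agree, and \<open>g\<close> itself. The additive form avoids truncated
  subtraction.\<close>

lemma compares_card_SF:
  assumes "wf_af F" and "g \<in> args F" and "L g = L' g"
  shows "label_dist F L L' + Suc (card {a \<in> args F - {g}. compares SF (L a) (L' a)}) =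
    card (args F)"
proof -
  let ?D = "{a \<in> args F. L a \<noteq> L' a}" and ?E = "{a \<in> args F - {g}. compares SF (L a) (L' a)}"
  have fin: "finite (args F)" using assms(1) unfolding wf_af_def by blast
  have "args F = ?D \<union> insert g ?E" using assms by auto
  then have "card (args F) = card (?D \<union> insert g ?E)" by simp
  also have "\<dots> = card ?D + card (insert g ?E)"
    using fin assms(3) by (intro card_Un_disjoint) auto
  finally show ?thesis using fin by (simp add: label_dist_def)
qed

theorem theorem9:
  fixes F :: "'a af" and g :: 'a and \<sigma> :: semantics and L :: "'a \<Rightarrow> label"
    and T :: explanation_type and enc :: "semantics \<Rightarrow> 'a program"
  assumes "wf_af F"
    and "g \<in> args F"
    and "L \<in> labellings \<sigma> F"
    and "asp_encoding F \<sigma> (enc \<sigma>)"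
  shows "explain enc F g \<sigma> L T =
    (case T of CF \<Rightarrow> counterfactuals \<sigma> F g L | SF \<Rightarrow> semifactuals \<sigma> F g L)"
proof -
  obtain f where P: "\<not> mentions (enc \<sigma>) P_w"
    and f: "f ` labellings \<sigma> F = answer_sets (prog_af F \<union> enc \<sigma>)"
    and rep: "\<And>L'. L' \<in> labellings \<sigma> F \<Longrightarrow> represents F (f L') L'"
    using assms(4) unfolding asp_encoding_def by (elim conjE exE) (metis bij_betw_imp_surj_on)
  let ?W = "weight_atoms F g L T" and ?C = "{L' \<in> labellings \<sigma> F. compares T (L g) (L' g)}"
  let ?cost = "\<lambda>L'. card {a \<in> args F - {g}. compares T (L a) (L' a)}"
  have answers: "answer_sets (prog_af F \<union> enc \<sigma> \<union> prog_S g L T \<union> prog_W F g L T) =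
      (\<lambda>L'. f L' \<union> ?W L') ` ?C"
    using assms(2) P f rep by (rule answer_sets_query)
  have "represents F (f L' \<union> ?W L') L'" if "L' \<in> ?C" for L'
  proof -
    \<comment> \<open>Adding \<open>w\<close>-atoms leaves the label atoms untouched, hence also the
      labelling that is read off.\<close>
    have "?W L' \<inter> label_atoms F = {}"
      unfolding weight_atoms_def label_atoms_def by auto
    then show ?thesis
      using rep[of L'] that represents_cong[of "f L' \<union> ?W L'" F "f L'"] by blast
  qed
  then have read: "represents F (f L' \<union> ?W L') L'' \<longleftrightarrow> L'' = L'" if "L' \<in> ?C" for L' L''
    using that represents_unique by blast
  have cost: "w_cost (f L' \<union> ?W L') = ?cost L'" if "L' \<in> ?C" for L'
  proof -
    have "f L' \<in> answer_sets (prog_af F \<union> enc \<sigma>)"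
      using f that by blast
    then have "Atm P_w [a] \<notin> f L'" for a
      using answer_set_not_mentions[OF not_mentions_prog_af_Un[OF P]] by fastforce
    then show ?thesis
      unfolding w_cost_def weight_atoms_def by simp
  qed
  \<comment> \<open>Every answer set comes from a labelling in \<open>?C\<close>;
    \<open>read\<close> recovers that labelling and \<open>cost\<close> transfers optimality to
    it.\<close>
  have "explain enc F g \<sigma> L T = {L' \<in> ?C. \<not> (\<exists>L''\<in>?C. ?cost L'' < ?cost L')}"
    unfolding explain_def optimal_answer_sets_def answers using read cost by auto
  also have "\<dots> = (case T of CF \<Rightarrow> counterfactuals \<sigma> F g L | SF \<Rightarrow> semifactuals \<sigma> F g L)"
  proof (cases T)
    case CF
    then show ?thesis
      unfolding counterfactuals_def by (auto simp: compares_card_CF[OF assms(1,2)])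
  next
    case SF
    \<comment> \<open>Cost and distance have the constant sum \<open>card (args F) - 1\<close>, so
      comparing costs reverses the comparison of distances.\<close>
    have "?cost L'' < ?cost L' \<longleftrightarrow> label_dist F L L'' > label_dist F L L'"
      if "L g = L' g" "L g = L'' g" for L' L''
      using compares_card_SF[OF assms(1,2), of L L'] compares_card_SF[OF assms(1,2), of L L'']
        that SF
      by auto
    then show ?thesis
      unfolding semifactuals_def using SF by auto
  qed
  finally show ?thesis .
qed

end
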